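(* Let $\Omega$ be the unit disc, with $R>\rho>1$. Let the Fourier coefficients of the analytic boundary data $v$ decay no faster than $\rho^{-|m|}$, that is, for some constant $c_v>0$, $$|\hat v(m)|\ge c_v\,\rho^{-|m|},\qquad m\in\mathbb{Z}.$$ For any positive even $N$ satisfying $N>3+N_{\min}$, where $$N_{\min}:=2\max\left[\frac{\ln\left(\sqrt{\tfrac{2}{\pi}}\,\tfrac{c}{c_v}\right)}{\ln\rho},\;1\right],$$ let $\bm\alpha$ be a coefficient vector such that the MFS representation with $N$ charge points equally spaced on the circle of radius $R$ has a boundary error norm satisfying $$t\le c\,\rho^{-N/2},$$ where $c>0$ is a constant independent of $N$. Then $$|\bm\alpha|\;\ge\; C\sqrt{N}\left(\frac{R}{\rho}\right)^{N/2}$$ for some constant $C>0$ which may depend on $k$, $R$, and $v$, but not on $N$.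
   Context: Identify $\mathbb{R}^2$ with $\mathbb{C}$. $\Omega=\{x:|x|<1\}$ is the unit disc, with boundary $\partial\Omega$ the unit circle, and $k>0$ is the wavenumber of the Helmholtz equation $\Delta u+k^2u=0$ in $\Omega$ with Dirichlet data $u=v$ on $\partial\Omega$. The Fourier coefficients of $v$ are $\hat v(m)=\frac{1}{2\pi}\int_0^{2\pi} v(e^{i\theta})e^{-im\theta}\,d\theta$, $m\in\mathbb{Z}$. For a positive even integer $N$, the charge points are $y_j=Re^{i\phi_j}$ with $\phi_j=2\pi j/N$, $j=1,\dots,N$. For a coefficient vector $\bm\alpha=(\alpha_1,\dots,\alpha_N)\in\mathbb{C}^N$, the Method of Fundamental Solutions (MFS) representation is $$u^{(N)}(x)=\frac{i}{4}\sum_{j=1}^N\alpha_j H_0^{(1)}(k|x-y_j|),$$ where $H_0^{(1)}$ is the Hankel function of the first kind of order zero. The boundary error norm is $t=\|u^{(N)}-v\|_{L^2(\partial\Omega)}$, and $|\bm\alpha|=(|\alpha_1|^2+\dots+|\alpha_N|^2)^{1/2}$ is the Euclidean norm. *)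

theory Defs
  imports "HOL-Complex_Analysis.Complex_Analysis"
begin

definition bessel_J0 :: "complex \<Rightarrow> complex" where
  "bessel_J0 z = (\<Sum>n. (-1) ^ n * (z / 2) ^ (2 * n) / (fact n)\<^sup>2)"

text \<open>
  The standard ascending series on the principal branch (cut along the negative real axis).
  Since \<open>harm 0 = 0\<close>, the second series effectively starts at \<open>n = 1\<close>.
\<close>
definition bessel_Y0 :: "complex \<Rightarrow> complex" where
  "bessel_Y0 z =
     2 / of_real pi * ((Ln (z / 2) + euler_mascheroni) * bessel_J0 z
       - (\<Sum>n. (-1) ^ n * harm n * (z / 2) ^ (2 * n) / (fact n)\<^sup>2))"

definition hankel1_0 :: "complex \<Rightarrow> complex" where
  "hankel1_0 z = bessel_J0 z + \<i> * bessel_Y0 z"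

definition circle_fourier_coeff :: "(complex \<Rightarrow> complex) \<Rightarrow> int \<Rightarrow> complex" where
  "circle_fourier_coeff v m =
     1 / (2 * of_real pi) *
     integral {0..2 * pi} (\<lambda>\<theta>. v (cis \<theta>) * cis (- (of_int m * \<theta>)))"

text \<open>The \<open>L\<^sup>2\<close> norm is taken with respect to (unnormalised) arc length.\<close>
definition circle_L2_norm :: "(complex \<Rightarrow> complex) \<Rightarrow> real" where
  "circle_L2_norm f = sqrt (integral {0..2 * pi} (\<lambda>\<theta>. (cmod (f (cis \<theta>)))\<^sup>2))"

text \<open>
  Boundary data are functions on the unit circle only, so analyticity is
  formulated through a holomorphic extension; the values of \<open>v\<close> off the circle are irrelevant.
\<close>
definition analytic_boundary_data :: "(complex \<Rightarrow> complex) \<Rightarrow> bool" where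
  "analytic_boundary_data v \<longleftrightarrow>
     (\<exists>f. f analytic_on sphere 0 1 \<and> (\<forall>x\<in>sphere 0 1. f x = v x))"

definition charge_point :: "real \<Rightarrow> nat \<Rightarrow> nat \<Rightarrow> complex" where
  "charge_point R N j = of_real R * cis (2 * pi * real j / real N)"

text \<open>Coefficient vectors are functions on \<^typ>\<open>nat\<close>; only the entries \<open>1, \<dots>, N\<close> are used.\<close>
definition mfs :: "real \<Rightarrow> real \<Rightarrow> nat \<Rightarrow> (nat \<Rightarrow> complex) \<Rightarrow> complex \<Rightarrow> complex" where
  "mfs k R N \<alpha> x =
     \<i> / 4 * (\<Sum>j = 1..N. \<alpha> j * hankel1_0 (of_real (k * cmod (x - charge_point R N j))))"

definition boundary_error ::
    "real \<Rightarrow> real \<Rightarrow> (complex \<Rightarrow> complex) \<Rightarrow> nat \<Rightarrow> (nat \<Rightarrow> complex) \<Rightarrow> real" where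
  "boundary_error k R v N \<alpha> = circle_L2_norm (\<lambda>x. mfs k R N \<alpha> x - v x)"

definition coeff_norm :: "nat \<Rightarrow> (nat \<Rightarrow> complex) \<Rightarrow> real" where
  "coeff_norm N \<alpha> = L2_set (\<lambda>j. cmod (\<alpha> j)) {1..N}"

definition N_min :: "real \<Rightarrow> real \<Rightarrow> real \<Rightarrow> real" where
  "N_min \<rho> c c\<^sub>v = 2 * max (ln (sqrt (2 / pi) * (c / c\<^sub>v)) / ln \<rho>) 1"

end

theory Submission
  imports Defs
begin

text \<open>
A single Fourier mode of index \<open>m\<close> slightly below \<open>N / 2\<close> already forces the coefficients to be
large. A charge at distance \<open>R\<close> produces boundary values whose \<open>m\<close>-th Fourier coefficient is at
most \<open>K R\<^sup>-\<^sup>m / (1 + m)\<close>, with \<open>K\<close> depending only on \<open>k\<close> and \<open>R\<close>; so the field of all \<open>N\<close> charges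
has \<open>m\<close>-th coefficient at most \<open>(K / 4) sqrt N |\<alpha>| R\<^sup>-\<^sup>m / (1 + m)\<close>, by Cauchy-Schwarz. If \<open>m\<close> lies a
suitable fixed distance \<open>D\<close> below \<open>N / 2\<close>, the permitted boundary error is at most half of the
lower bound \<open>c\<^sub>v \<rho>\<^sup>-\<^sup>m\<close> for the data, so the field must reproduce the other half. Comparing the two
bounds gives \<open>|\<alpha>| \<ge> const (1 + m) (R / \<rho>)\<^sup>m / sqrt N\<close>, and here \<open>1 + m\<close> is comparable with \<open>N\<close>
and \<open>(R / \<rho>)\<^sup>m\<close> with \<open>(R / \<rho>)\<^sup>N\<^sup>/\<^sup>2\<close>. The factor \<open>1 / (1 + m)\<close> in the first bound is what yields
\<open>sqrt N\<close> rather than \<open>1 / sqrt N\<close> in the conclusion.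

The bound for one charge \<open>y\<close> replaces Graf's addition theorem and the asymptotics of Bessel
functions by an elementary argument. On the circle \<open>w = |z - y|\<^sup>2\<close> is a trigonometric polynomial
of degree one, and \<open>H\<^sub>0(k |z - y|)\<close> is \<open>A(w) (const + const ln |1 - z / y|) + B(w)\<close> with entire \<open>A\<close>
and \<open>B\<close>. The coefficients of the logarithm are explicit and of size \<open>R\<^sup>-\<^sup>|\<^sup>m\<^sup>| / |m|\<close>
(\<open>fourier_decay_ln_dist\<close>). Since the weight \<open>(1 + |m|) R\<^sup>|\<^sup>m\<^sup>|\<close> grows by at most a fixed factor when
\<open>m\<close> moves by one, multiplication by \<open>w\<close> preserves this decay up to a constant factor, hence so does
multiplication by an entire function of \<open>w\<close> (\<open>fourier_decay_entire_dist_squared\<close>). Together they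
give \<open>fourier_decay_hankel1_0\<close>.
\<close>

section \<open>Fourier coefficients on the unit circle\<close>

lemma circle_integrand_continuous:
  assumes "continuous_on (sphere 0 1) f"
  shows "continuous_on {0..2 * pi} (\<lambda>\<theta>. f (cis \<theta>) * cis (- (of_int m * \<theta>)))"
  by (intro continuous_intros continuous_on_compose2[OF assms]) auto

lemma circle_fourier_coeff_add:
  assumes "continuous_on (sphere 0 1) f" "continuous_on (sphere 0 1) g"
  shows "circle_fourier_coeff (\<lambda>z. f z + g z) m = circle_fourier_coeff f m + circle_fourier_coeff g m"
  unfolding circle_fourier_coeff_def distrib_right
  by (subst integral_add)
     (auto intro!: integrable_continuous_interval circle_integrand_continuous assms simp: distrib_left)

lemma circle_fourier_coeff_cmult:
  "circle_fourier_coeff (\<lambda>z. a * f z) m = a * circle_fourier_coeff f m"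
  by (simp add: circle_fourier_coeff_def mult.assoc)

lemma circle_fourier_coeff_diff:
  assumes "continuous_on (sphere 0 1) f" "continuous_on (sphere 0 1) g"
  shows "circle_fourier_coeff (\<lambda>z. f z - g z) m = circle_fourier_coeff f m - circle_fourier_coeff g m"
  using circle_fourier_coeff_add[OF assms(1), of "\<lambda>z. (-1) * g z" m]
    circle_fourier_coeff_cmult[of "-1" g m] assms(2)
  by (auto intro!: continuous_intros)

lemma circle_fourier_coeff_cong:
  assumes "\<And>z. z \<in> sphere 0 1 \<Longrightarrow> f z = g z"
  shows "circle_fourier_coeff f m = circle_fourier_coeff g m"
  unfolding circle_fourier_coeff_def using assms by (simp cong: integral_cong)

text \<open>
Conjugation inverts \<open>z\<close> on the circle, so \<open>z\<close> and \<open>cnj z\<close> act on the coefficients as opposite shifts. All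
products with trigonometric polynomials below are reduced to these two.
\<close>

lemma circle_fourier_coeff_mult_z:
  "circle_fourier_coeff (\<lambda>z. z * f z) m = circle_fourier_coeff f (m - 1)"
proof -
  have "cis \<theta> * f (cis \<theta>) * cis (- (of_int m * \<theta>)) =
        f (cis \<theta>) * cis (- (of_int (m - 1) * \<theta>))" for \<theta>
    by (simp add: mult.commute mult.left_commute cis_mult algebra_simps)
  then show ?thesis
    unfolding circle_fourier_coeff_def by (simp only:)
qed

lemma circle_fourier_coeff_mult_cnj:
  "circle_fourier_coeff (\<lambda>z. cnj z * f z) m = circle_fourier_coeff f (m + 1)"
proof -
  have "cnj (cis \<theta>) * f (cis \<theta>) * cis (- (of_int m * \<theta>)) =
        f (cis \<theta>) * cis (- (of_int (m + 1) * \<theta>))" for \<theta>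
    by (simp add: mult.commute mult.left_commute cis_mult cis_cnj algebra_simps)
  then show ?thesis
    unfolding circle_fourier_coeff_def by (simp only:)
qed

lemma circle_fourier_coeff_const_1:
  "circle_fourier_coeff (\<lambda>z. 1) m = (if m = 0 then 1 else 0)"
proof (cases "m = 0")
  case True
  then show ?thesis by (simp add: circle_fourier_coeff_def scaleR_conv_of_real)
next
  case False
  define a :: complex where "a = - \<i> * of_int m"
  have a: "a \<noteq> 0" using False by (simp add: a_def)
  have e: "cis (- (of_int m * \<theta>)) = exp (a * of_real \<theta>)" for \<theta>
    by (simp add: cis_conv_exp a_def mult_ac)
  have "((\<lambda>\<theta>. exp (a * of_real \<theta>)) has_integral
          (exp (a * of_real (2 * pi)) / a - exp (a * of_real 0) / a)) {0..2 * pi}"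
    using a by (intro fundamental_theorem_of_calculus)
      (auto intro!: derivative_eq_intros has_vector_derivative_real_field simp: field_simps)
  moreover have "exp (a * of_real (2 * pi)) = 1"
    using cis_multiple_2pi[of "- of_int m"] by (subst e[symmetric]) (simp add: mult_ac)
  ultimately have "integral {0..2 * pi} (\<lambda>\<theta>. exp (a * of_real \<theta>)) = 0"
    by (simp add: integral_unique)
  with False show ?thesis
    unfolding circle_fourier_coeff_def e by simp
qed

lemma circle_fourier_coeff_power:
  "circle_fourier_coeff (\<lambda>z. z ^ n) m = (if m = int n then 1 else 0)"
proof (induction n arbitrary: m)
  case (Suc n)
  then show ?case using circle_fourier_coeff_mult_z[of "\<lambda>z. z ^ n" m] by auto
qed (use circle_fourier_coeff_const_1 in auto)

lemma circle_fourier_coeff_cnj_power: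
  "circle_fourier_coeff (\<lambda>z. cnj z ^ n) m = (if m = - int n then 1 else 0)"
proof (induction n arbitrary: m)
  case (Suc n)
  then show ?case using circle_fourier_coeff_mult_cnj[of "\<lambda>z. cnj z ^ n" m] by auto
qed (use circle_fourier_coeff_const_1 in auto)

lemma circle_fourier_coeff_sum:
  assumes "\<And>n. n \<in> A \<Longrightarrow> continuous_on (sphere 0 1) (f n)"
  shows "circle_fourier_coeff (\<lambda>z. \<Sum>n\<in>A. f n z) m = (\<Sum>n\<in>A. circle_fourier_coeff (f n) m)"
  unfolding circle_fourier_coeff_def sum_distrib_right
  using assms
  by (cases "finite A")
     (subst integral_sum, auto intro!: integrable_continuous_interval circle_integrand_continuous
       simp: sum_distrib_left)

text \<open>
Under Weierstrass' condition the partial sums converge uniformly, so integration commutes with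
the infinite sum.
\<close>

lemma circle_fourier_coeff_sums:
  fixes f :: "nat \<Rightarrow> complex \<Rightarrow> complex"
  assumes cont: "\<And>n. continuous_on (sphere 0 1) (f n)"
    and bound: "\<And>n z. z \<in> sphere 0 1 \<Longrightarrow> cmod (f n z) \<le> M n"
    and "summable M"
  shows "continuous_on (sphere 0 1) (\<lambda>z. \<Sum>n. f n z)"
    and "(\<lambda>n. circle_fourier_coeff (f n) m) sums circle_fourier_coeff (\<lambda>z. \<Sum>n. f n z) m"
proof -
  have u: "uniform_limit (sphere 0 1) (\<lambda>n z. \<Sum>i<n. f i z) (\<lambda>z. \<Sum>n. f n z) sequentially"
    by (rule Weierstrass_m_test) (use bound \<open>summable M\<close> in auto)
  show "continuous_on (sphere 0 1) (\<lambda>z. \<Sum>n. f n z)"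
    by (rule uniform_limit_theorem[OF _ u]) (auto intro!: always_eventually continuous_intros cont)
  have "uniform_limit {0..2 * pi} (\<lambda>n \<theta>. (\<Sum>i<n. f i (cis \<theta>)) * cis (- (of_int m * \<theta>)))
          (\<lambda>\<theta>. (\<Sum>n. f n (cis \<theta>)) * cis (- (of_int m * \<theta>))) sequentially"
    unfolding uniform_limit_iff dist_norm left_diff_distrib[symmetric] norm_mult norm_cis mult_1_right
  proof (intro allI impI)
    fix e :: real assume "e > 0"
    show "\<forall>\<^sub>F n in sequentially. \<forall>\<theta>\<in>{0..2 * pi}. cmod ((\<Sum>i<n. f i (cis \<theta>)) - (\<Sum>n. f n (cis \<theta>))) < e"
      using uniform_limitD[OF u \<open>e > 0\<close>] by (rule eventually_mono) (auto simp: dist_norm)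
  qed
  moreover have "continuous_on {0..2 * pi} (\<lambda>\<theta>. (\<Sum>i<n. f i (cis \<theta>)) * cis (- (of_int m * \<theta>)))" for n
    by (intro continuous_intros continuous_on_compose2[OF cont]) auto
  ultimately obtain I J where
    I: "\<And>n. ((\<lambda>\<theta>. (\<Sum>i<n. f i (cis \<theta>)) * cis (- (of_int m * \<theta>))) has_integral I n) {0..2 * pi}"
    and J: "((\<lambda>\<theta>. (\<Sum>n. f n (cis \<theta>)) * cis (- (of_int m * \<theta>))) has_integral J) {0..2 * pi}"
    and lim: "I \<longlonglongrightarrow> J"
    by (rule uniform_limit_integral) auto
  have "(\<Sum>i<n. circle_fourier_coeff (f i) m) = 1 / (2 * of_real pi) * I n" for n
    using integral_unique[OF I[of n]]
    by (subst circle_fourier_coeff_sum[symmetric, OF cont]) (simp add: circle_fourier_coeff_def)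
  moreover have "circle_fourier_coeff (\<lambda>z. \<Sum>n. f n z) m = 1 / (2 * of_real pi) * J"
    using integral_unique[OF J] by (simp add: circle_fourier_coeff_def)
  ultimately show "(\<lambda>n. circle_fourier_coeff (f n) m) sums circle_fourier_coeff (\<lambda>z. \<Sum>n. f n z) m"
    unfolding sums_def by (auto intro!: tendsto_intros lim)
qed

text \<open>
The Cauchy-Schwarz inequality in the form that the square of a mean value is at most the mean of
the squares. The norm is taken for unnormalised arc length, hence the factor \<open>sqrt (2 * pi)\<close>.
\<close>

lemma cmod_circle_fourier_coeff_le:
  assumes f: "continuous_on (sphere 0 1) f"
  shows "cmod (circle_fourier_coeff f m) \<le> circle_L2_norm f / sqrt (2 * pi)"
proof -
  define g where "g = (\<lambda>\<theta>. cmod (f (cis \<theta>)))"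
  have g: "continuous_on {0..2 * pi} g"
    unfolding g_def
    by (rule continuous_on_norm, rule continuous_on_compose2[OF f, of _ cis])
       (auto intro!: continuous_intros)
  define a where "a = integral {0..2 * pi} g / (2 * pi)"
  have a0: "a \<ge> 0"
    unfolding a_def
    by (intro divide_nonneg_nonneg integral_nonneg integrable_continuous_interval g) (auto simp: g_def)
  have "cmod (integral {0..2 * pi} (\<lambda>\<theta>. f (cis \<theta>) * cis (- (of_int m * \<theta>)))) \<le> integral {0..2 * pi} g"
    by (rule integral_norm_bound_integral)
       (auto intro!: integrable_continuous_interval circle_integrand_continuous f g[unfolded g_def]
          simp: g_def norm_mult)
  then have 1: "cmod (circle_fourier_coeff f m) \<le> a"
    by (simp add: circle_fourier_coeff_def a_def norm_mult norm_divide divide_right_mono)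
  \<comment> \<open>The tangent to the square function at the mean value \<open>a\<close> of \<open>g\<close>; integrating it gives the
      comparison of means.\<close>
  have "2 * a * g \<theta> - a\<^sup>2 \<le> (g \<theta>)\<^sup>2" for \<theta>
    using zero_le_power2[of "g \<theta> - a"] by (simp add: power2_diff mult_ac)
  then have "integral {0..2 * pi} (\<lambda>\<theta>. 2 * a * g \<theta> - a\<^sup>2) \<le> integral {0..2 * pi} (\<lambda>\<theta>. (g \<theta>)\<^sup>2)"
    by (intro integral_le integrable_continuous_interval continuous_intros g) auto
  moreover have "integral {0..2 * pi} (\<lambda>\<theta>. 2 * a * g \<theta> - a\<^sup>2) = 2 * a * integral {0..2 * pi} g - 2 * pi * a\<^sup>2"
    by (subst integral_diff) (auto intro!: integrable_continuous_interval continuous_intros g)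
  moreover have "integral {0..2 * pi} g = 2 * pi * a" by (simp add: a_def)
  ultimately have "2 * pi * a\<^sup>2 \<le> integral {0..2 * pi} (\<lambda>\<theta>. (g \<theta>)\<^sup>2)"
    by (simp add: power2_eq_square)
  then have "sqrt (2 * pi * a\<^sup>2) \<le> circle_L2_norm f"
    unfolding circle_L2_norm_def g_def by (rule real_sqrt_le_mono)
  then have "a * sqrt (2 * pi) \<le> circle_L2_norm f"
    using a0 by (simp add: real_sqrt_mult mult_ac)
  then have "a \<le> circle_L2_norm f / sqrt (2 * pi)" by (simp add: pos_le_divide_eq)
  with 1 show ?thesis by (rule order_trans)
qed

section \<open>Functions whose Fourier coefficients decay like those of the logarithm\<close>

text \<open>
The weight is the reciprocal of \<open>R\<^sup>-\<^sup>|\<^sup>m\<^sup>| / (1 + |m|)\<close>, the decay enforced by a logarithmic singularity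
at distance \<open>R\<close>. Recording the constant \<open>C\<close> explicitly makes it possible to sum series of such
functions and to have bounds that are uniform in the position of the singularity.
\<close>

definition fourier_decay :: "real \<Rightarrow> real \<Rightarrow> (complex \<Rightarrow> complex) \<Rightarrow> bool" where
  "fourier_decay R C f \<longleftrightarrow> continuous_on (sphere 0 1) f \<and>
     (\<forall>m. (1 + real_of_int \<bar>m\<bar>) * R ^ nat \<bar>m\<bar> * cmod (circle_fourier_coeff f m) \<le> C)"

lemma fourier_decayD:
  assumes "fourier_decay R C f"
  shows "continuous_on (sphere 0 1) f"
    and "(1 + real_of_int \<bar>m\<bar>) * R ^ nat \<bar>m\<bar> * cmod (circle_fourier_coeff f m) \<le> C"
  using assms by (auto simp only: fourier_decay_def)

lemma fourier_decay_cong: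
  assumes "fourier_decay R C f" and eq: "\<And>z. z \<in> sphere 0 1 \<Longrightarrow> f z = g z"
  shows "fourier_decay R C g"
  using assms(1) circle_fourier_coeff_cong[of f g, OF eq] continuous_on_cong[of "sphere 0 1" _ f g, OF refl eq]
  by (simp add: fourier_decay_def)

lemma fourier_decay_add:
  assumes "fourier_decay R C f" "fourier_decay R D g" "R \<ge> 0"
  shows "fourier_decay R (C + D) (\<lambda>z. f z + g z)"
  unfolding fourier_decay_def
proof (intro conjI allI)
  fix m
  let ?w = "(1 + real_of_int \<bar>m\<bar>) * R ^ nat \<bar>m\<bar>"
  have "?w * cmod (circle_fourier_coeff (\<lambda>z. f z + g z) m) \<le>
        ?w * (cmod (circle_fourier_coeff f m) + cmod (circle_fourier_coeff g m))"
    using assms by (intro mult_left_mono) (auto simp: fourier_decay_def circle_fourier_coeff_add norm_triangle_ineq)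
  also have "\<dots> \<le> C + D"
    using assms unfolding distrib_left fourier_decay_def by (intro add_mono) auto
  finally show "?w * cmod (circle_fourier_coeff (\<lambda>z. f z + g z) m) \<le> C + D" .
qed (use assms in \<open>auto simp: fourier_decay_def intro!: continuous_intros\<close>)

lemma fourier_decay_mono: "fourier_decay R C f \<Longrightarrow> C \<le> D \<Longrightarrow> fourier_decay R D f"
  unfolding fourier_decay_def using order_trans by blast

lemma fourier_decay_sum:
  assumes "finite A" "\<And>j. j \<in> A \<Longrightarrow> fourier_decay R (C j) (f j)" "R \<ge> 0"
  shows "fourier_decay R (\<Sum>j\<in>A. C j) (\<lambda>z. \<Sum>j\<in>A. f j z)"
  using assms
proof (induction A)
  case empty
  show ?case by (simp add: fourier_decay_def circle_fourier_coeff_def)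
qed (auto intro!: fourier_decay_add)

lemma fourier_decay_cmult:
  assumes "fourier_decay R C f"
  shows "fourier_decay R (cmod a * C) (\<lambda>z. a * f z)"
proof -
  have "(1 + real_of_int \<bar>m\<bar>) * R ^ nat \<bar>m\<bar> * (cmod a * cmod (circle_fourier_coeff f m)) \<le> cmod a * C" for m
    using mult_left_mono[OF fourier_decayD(2)[OF assms] norm_ge_zero[of a]] by (simp only: mult_ac)
  with assms show ?thesis
    by (auto simp: fourier_decay_def circle_fourier_coeff_cmult norm_mult intro!: continuous_intros)
qed

text \<open>
The weight is slowly varying in this sense: a step of one in the index costs at most the factor
\<open>2 R\<close>, of which \<open>R\<close> comes from the power and \<open>2\<close> from the linear factor.
\<close>

lemma fourier_weight_step:
  assumes "R \<ge> 1" "\<bar>m\<bar> \<le> \<bar>m'\<bar> + 1"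
  shows "(1 + real_of_int \<bar>m\<bar>) * R ^ nat \<bar>m\<bar> \<le> 2 * R * ((1 + real_of_int \<bar>m'\<bar>) * R ^ nat \<bar>m'\<bar>)"
proof -
  have "R ^ nat \<bar>m\<bar> \<le> R ^ Suc (nat \<bar>m'\<bar>)"
    using assms by (intro power_increasing) auto
  moreover have "1 + real_of_int \<bar>m\<bar> \<le> 2 * (1 + real_of_int \<bar>m'\<bar>)"
    using assms(2) by simp
  ultimately have "(1 + real_of_int \<bar>m\<bar>) * R ^ nat \<bar>m\<bar> \<le> 2 * (1 + real_of_int \<bar>m'\<bar>) * R ^ Suc (nat \<bar>m'\<bar>)"
    using assms(1) by (intro mult_mono) auto
  then show ?thesis by (simp only: mult_ac power_Suc)
qed

lemma fourier_decay_shift: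
  assumes f: "fourier_decay R C f" and "R \<ge> 1" and g: "continuous_on (sphere 0 1) g"
    and shift: "\<And>m. circle_fourier_coeff g m = circle_fourier_coeff f (m + s)" and "\<bar>s\<bar> = 1"
  shows "fourier_decay R (2 * R * C) g"
  unfolding fourier_decay_def
proof (intro conjI allI g)
  fix m
  have "(1 + real_of_int \<bar>m\<bar>) * R ^ nat \<bar>m\<bar> * cmod (circle_fourier_coeff g m) \<le>
        2 * R * ((1 + real_of_int \<bar>m + s\<bar>) * R ^ nat \<bar>m + s\<bar>) * cmod (circle_fourier_coeff f (m + s))"
    unfolding shift using assms by (intro mult_right_mono fourier_weight_step) auto
  also have "\<dots> = 2 * R * ((1 + real_of_int \<bar>m + s\<bar>) * R ^ nat \<bar>m + s\<bar> * cmod (circle_fourier_coeff f (m + s)))"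
    by (simp add: mult_ac)
  also have "\<dots> \<le> 2 * R * C"
    using \<open>R \<ge> 1\<close> by (intro mult_left_mono fourier_decayD(2)[OF f]) auto
  finally show "(1 + real_of_int \<bar>m\<bar>) * R ^ nat \<bar>m\<bar> * cmod (circle_fourier_coeff g m) \<le> 2 * R * C" .
qed

lemma fourier_decay_mult_z:
  assumes "fourier_decay R C f" "R \<ge> 1"
  shows "fourier_decay R (2 * R * C) (\<lambda>z. z * f z)"
  using assms circle_fourier_coeff_mult_z
  by (intro fourier_decay_shift[of R C f _ "- 1"])
     (auto simp: fourier_decay_def intro!: continuous_intros)

lemma fourier_decay_mult_cnj:
  assumes "fourier_decay R C f" "R \<ge> 1"
  shows "fourier_decay R (2 * R * C) (\<lambda>z. cnj z * f z)"
  using assms circle_fourier_coeff_mult_cnj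
  by (intro fourier_decay_shift[of R C f _ 1])
     (auto simp: fourier_decay_def intro!: continuous_intros)

text \<open>
On the circle \<open>cnj z\<close> is the inverse of \<open>z\<close>, so the squared distance to a fixed point is a Laurent
polynomial of degree one in \<open>z\<close>.
\<close>

lemma cmod_diff_squared_on_circle:
  assumes "z \<in> sphere 0 1"
  shows "of_real ((cmod (z - y))\<^sup>2) = of_real (1 + (cmod y)\<^sup>2) + (- cnj y) * z + (- y) * cnj z"
proof -
  have "z * cnj z = 1" using assms by (simp add: complex_norm_square[symmetric])
  then show ?thesis
    by (simp add: complex_norm_square algebra_simps del: of_real_power)
qed

text \<open>
The three terms of that Laurent polynomial contribute \<open>1 + R\<^sup>2\<close> and twice \<open>R (2 R)\<close> to the factor.
\<close>

lemma fourier_decay_mult_dist_squared: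
  assumes f: "fourier_decay R C f" and "R \<ge> 1" and y: "cmod y = R"
  shows "fourier_decay R ((5 * R\<^sup>2 + 1) * C) (\<lambda>z. of_real ((cmod (z - y))\<^sup>2) * f z)"
proof -
  have "fourier_decay R (cmod (of_real (1 + R\<^sup>2)) * C + cmod (- cnj y) * (2 * R * C) + cmod (- y) * (2 * R * C))
     (\<lambda>z. of_real (1 + R\<^sup>2) * f z + (- cnj y) * (z * f z) + (- y) * (cnj z * f z))"
    using assms by (intro fourier_decay_add fourier_decay_cmult fourier_decay_mult_z fourier_decay_mult_cnj) auto
  moreover have "cmod (of_real (1 + R\<^sup>2)) * C + cmod (- cnj y) * (2 * R * C) + cmod (- y) * (2 * R * C) = (5 * R\<^sup>2 + 1) * C"
    using y by (simp only: norm_of_real norm_minus_cancel complex_mod_cnj) (simp add: power2_eq_square algebra_simps)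
  ultimately show ?thesis
    by (auto simp only: cmod_diff_squared_on_circle y distrib_right mult.assoc intro: fourier_decay_cong)
qed

lemma fourier_decay_nonneg:
  assumes "fourier_decay R C f"
  shows "C \<ge> 0"
proof -
  have "cmod (circle_fourier_coeff f 0) \<le> C"
    using fourier_decayD(2)[OF assms, of 0] by simp
  then show ?thesis by (rule order_trans[OF norm_ge_zero])
qed

text \<open>
With \<open>w = |z - y|\<^sup>2\<close>, each factor \<open>w\<close> multiplies the constant by at most \<open>5 R\<^sup>2 + 1\<close>, so
\<open>w\<^sup>n f\<close> decays with constant \<open>(5 R\<^sup>2 + 1)\<^sup>n C\<close>. The bound \<open>a\<^sup>n / n!\<close> on the coefficients of the series absorbs
this geometric growth, and the constants sum to an exponential that is the same for all \<open>y\<close> with \<open>|y| = R\<close>.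
\<close>

lemma fourier_decay_entire_dist_squared:
  assumes f: "fourier_decay R C f" and R: "R \<ge> 1" and y: "cmod y = R"
    and b: "\<And>n. cmod (b n) \<le> a ^ n / fact n" and a: "a \<ge> 0"
  shows "fourier_decay R (C * exp (a * (5 * R\<^sup>2 + 1))) (\<lambda>z. (\<Sum>n. b n * of_real ((cmod (z - y))\<^sup>2) ^ n) * f z)"
proof -
  let ?w = "\<lambda>z. complex_of_real ((cmod (z - y))\<^sup>2)"
  let ?W = "5 * R\<^sup>2 + 1"
  have C: "C \<ge> 0" using f by (rule fourier_decay_nonneg)
  have cont: "continuous_on (sphere 0 1) f" using f by (simp add: fourier_decay_def)
  obtain B where B: "\<And>z. z \<in> sphere 0 1 \<Longrightarrow> cmod (f z) \<le> B"
    using compact_imp_bounded[OF compact_continuous_image[OF cont compact_sphere]]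
    unfolding bounded_iff by blast
  have pw: "fourier_decay R (?W ^ n * C) (\<lambda>z. ?w z ^ n * f z)" for n
  proof (induction n)
    case (Suc n)
    from fourier_decay_mult_dist_squared[OF this R y] show ?case by (simp add: mult_ac)
  qed (use f in simp)
  have expS: "(\<lambda>n. (x :: real) ^ n / fact n) sums exp x" for x
    using exp_converges[of x] by (simp add: divide_inverse mult.commute)
  have dec: "fourier_decay R (cmod (b n) * (?W ^ n * C)) (\<lambda>z. b n * (?w z ^ n * f z))" for n
    by (intro fourier_decay_cmult pw)
  have wB: "(cmod (z - y))\<^sup>2 \<le> (1 + R)\<^sup>2" if "z \<in> sphere 0 1" for z
    using norm_triangle_ineq4[of z y] that y R by (intro power_mono) auto
  \<comment> \<open>A pointwise bound, which serves only for uniform convergence on the circle; the decay of the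
      sum is read off from \<open>dec\<close>.\<close>
  have bound: "cmod (b n * (?w z ^ n * f z)) \<le> (a * (1 + R)\<^sup>2) ^ n / fact n * B" if z: "z \<in> sphere 0 1" for n z
  proof -
    have "cmod (b n * (?w z ^ n * f z)) = cmod (b n) * (((cmod (z - y))\<^sup>2) ^ n * cmod (f z))"
      by (simp add: norm_mult norm_power del: of_real_power)
    also have "\<dots> \<le> a ^ n / fact n * (((1 + R)\<^sup>2) ^ n * B)"
      by (intro mult_mono b power_mono[OF wB[OF z]] B[OF z]) (use a in auto)
    finally show ?thesis by (simp add: power_mult_distrib)
  qed
  have summ: "summable (\<lambda>n. (a * (1 + R)\<^sup>2) ^ n / fact n * B)"
    using expS by (intro summable_mult2) (auto simp: sums_iff)
  note S = circle_fourier_coeff_sums[OF _ bound summ]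
  have cn: "continuous_on (sphere 0 1) (\<lambda>z. b n * (?w z ^ n * f z))" for n
    using dec by (simp add: fourier_decay_def)
  have "fourier_decay R (C * exp (a * ?W)) (\<lambda>z. \<Sum>n. b n * (?w z ^ n * f z))"
    unfolding fourier_decay_def
  proof (intro conjI allI)
    show "continuous_on (sphere 0 1) (\<lambda>z. \<Sum>n. b n * (?w z ^ n * f z))" by (rule S(1)[OF cn])
    fix m
    let ?u = "(1 + real_of_int \<bar>m\<bar>) * R ^ nat \<bar>m\<bar>"
    let ?F = "\<lambda>n. circle_fourier_coeff (\<lambda>z. b n * (?w z ^ n * f z)) m"
    have u0: "?u \<ge> 0" using R by auto
    have 1: "(\<lambda>n. of_real ?u * ?F n) sums (of_real ?u * circle_fourier_coeff (\<lambda>z. \<Sum>n. b n * (?w z ^ n * f z)) m)"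
      by (intro sums_mult S(2)[OF cn])
    have 2: "(\<lambda>n. C * ((a * ?W) ^ n / fact n)) sums (C * exp (a * ?W))"
      by (intro sums_mult expS)
    have 3: "cmod (of_real ?u * ?F n) \<le> C * ((a * ?W) ^ n / fact n)" for n
    proof -
      have "cmod (of_real ?u * ?F n) = ?u * cmod (?F n)"
        using u0 by (simp only: norm_mult norm_of_real abs_of_nonneg)
      also have "\<dots> \<le> cmod (b n) * (?W ^ n * C)"
        using dec[of n] unfolding fourier_decay_def by blast
      also have "\<dots> \<le> a ^ n / fact n * (?W ^ n * C)"
        using C by (intro mult_right_mono b) auto
      finally show ?thesis by (simp add: power_mult_distrib mult_ac)
    qed
    have "cmod (of_real ?u * circle_fourier_coeff (\<lambda>z. \<Sum>n. b n * (?w z ^ n * f z)) m) \<le> C * exp (a * ?W)"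
      using norm_suminf_le[OF 3 sums_summable[OF 2]]
      by (simp only: sums_unique[OF 1, symmetric] sums_unique[OF 2, symmetric])
    then show "?u * cmod (circle_fourier_coeff (\<lambda>z. \<Sum>n. b n * (?w z ^ n * f z)) m) \<le> C * exp (a * ?W)"
      using u0 by (simp only: norm_mult norm_of_real abs_of_nonneg)
  qed
  then show ?thesis
  proof (rule fourier_decay_cong)
    fix z :: complex assume z: "z \<in> sphere 0 1"
    have "summable (\<lambda>n. b n * ?w z ^ n)"
    proof (rule summable_comparison_test')
      show "summable (\<lambda>n. (a * (1 + R)\<^sup>2) ^ n / fact n)" using expS by (auto simp: sums_iff)
      fix n
      have "norm (b n * ?w z ^ n) = cmod (b n) * ((cmod (z - y))\<^sup>2) ^ n"
        by (simp add: norm_mult norm_power del: of_real_power)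
      also have "\<dots> \<le> a ^ n / fact n * ((1 + R)\<^sup>2) ^ n"
        by (intro mult_mono b power_mono[OF wB[OF z]]) (use a in auto)
      finally show "norm (b n * ?w z ^ n) \<le> (a * (1 + R)\<^sup>2) ^ n / fact n" by (simp add: power_mult_distrib)
    qed
    then show "(\<Sum>n. b n * (?w z ^ n * f z)) = (\<Sum>n. b n * ?w z ^ n) * f z"
      by (simp only: mult.assoc[symmetric] suminf_mult2)
  qed
qed

lemma fourier_decay_const_1: "fourier_decay R 1 (\<lambda>z. 1)"
  by (auto simp: fourier_decay_def circle_fourier_coeff_const_1)

section \<open>The logarithm of the distance to an exterior point\<close>

text \<open>
The real part of the logarithm series. Its summand at \<open>n = 0\<close> is a division by zero, hence \<open>0\<close>.
\<close>

lemma ln_cmod_one_minus_sums: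
  assumes "cmod q < 1"
  shows "(\<lambda>n. - (q ^ n + cnj q ^ n) / (2 * of_nat n)) sums of_real (ln (cmod (1 - q)))"
proof -
  have "(\<lambda>n. - (q ^ n) / of_nat n) sums Ln (1 - q)"
    using Ln_series'[of "- q"] assms by simp
  then have "(\<lambda>n. of_real (Re (- (q ^ n) / of_nat n)) :: complex) sums of_real (Re (Ln (1 - q)))"
    by (intro sums_of_real sums_Re)
  moreover have "1 - q \<noteq> 0" using assms by auto
  moreover have "of_real (Re (- (q ^ n) / of_nat n)) = - (q ^ n + cnj q ^ n) / (2 * of_nat n)" for n
  proof -
    have "of_real (Re (- (q ^ n) / of_nat n)) = (- (q ^ n) / of_nat n + cnj (- (q ^ n) / of_nat n)) / 2"
      by (subst complex_add_cnj) (simp del: complex_cnj_divide)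
    then show ?thesis
      by (simp only: complex_cnj_minus complex_cnj_divide complex_cnj_power complex_cnj_of_nat
            add_divide_distrib minus_divide_left minus_add_distrib divide_divide_eq_left mult.commute)
  qed
  ultimately show ?thesis by (simp add: sums_def)
qed

text \<open>
Expanding \<open>ln |1 - z / y|\<close> in powers of \<open>z / y\<close> and of its conjugate shows that the coefficient of
index \<open>m \<noteq> 0\<close> has modulus \<open>R\<^sup>-\<^sup>|\<^sup>m\<^sup>| / (2 |m|)\<close>, while the one of index \<open>0\<close> vanishes. Multiplied by
the weight, these moduli stay above \<open>1 / 2\<close>, so the decay constants of the terms of the series cannot
be added up; instead each coefficient is computed exactly.
\<close>

lemma fourier_decay_ln_dist:
  assumes R: "R > 1" and y: "cmod y = R"
  shows "fourier_decay R 2 (\<lambda>z. of_real (ln (cmod (1 - z / y))))"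
proof -
  define f where "f = (\<lambda>n z. - ((z / y) ^ n + cnj (z / y) ^ n) / (2 * of_nat n))"
  have f_eq: "f n z = (- (1 / y ^ n) / (2 * of_nat n)) * z ^ n + (- (1 / cnj y ^ n) / (2 * of_nat n)) * cnj z ^ n" for n z
    by (simp add: f_def power_divide add_divide_distrib diff_divide_distrib)
  have cont: "continuous_on (sphere 0 1) (f n)" for n
    unfolding f_eq by (intro continuous_intros)
  have bound: "cmod (f n z) \<le> (1 / R) ^ n" if "z \<in> sphere 0 1" for n z
  proof (cases "n = 0")
    case False
    have "cmod ((z / y) ^ n + cnj (z / y) ^ n) \<le> 2 * (1 / R) ^ n"
      using norm_triangle_ineq[of "(z / y) ^ n" "cnj (z / y) ^ n"] that y
      by (simp add: norm_power norm_divide)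
    then have "cmod (f n z) \<le> (2 * (1 / R) ^ n) / (2 * real n)"
      unfolding f_def norm_divide norm_minus_cancel norm_mult norm_numeral norm_of_nat by (rule divide_right_mono) simp
    also have "\<dots> \<le> (1 / R) ^ n"
      using False R by (simp add: field_simps)
    finally show ?thesis .
  qed (simp add: f_def)
  have summ: "summable (\<lambda>n. (1 / R) ^ n)"
    using R by (intro summable_geometric) auto
  note S = circle_fourier_coeff_sums[OF cont bound summ]
  have "fourier_decay R 2 (\<lambda>z. \<Sum>n. f n z)"
    unfolding fourier_decay_def
  proof (intro conjI allI S(1))
    fix m
    define n where "n = nat \<bar>m\<bar>"
    have F: "circle_fourier_coeff (f j) m =
       (- (1 / y ^ j) / (2 * of_nat j)) * (if m = int j then 1 else 0) +
       (- (1 / cnj y ^ j) / (2 * of_nat j)) * (if m = - int j then 1 else 0)" for j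
      unfolding f_eq
      by (subst circle_fourier_coeff_add)
         (auto intro!: continuous_intros simp only: circle_fourier_coeff_cmult
            circle_fourier_coeff_power circle_fourier_coeff_cnj_power)
    \<comment> \<open>Only the summand \<open>n = |m|\<close> of the series contributes to the coefficient of index \<open>m\<close>.\<close>
    have "circle_fourier_coeff (\<lambda>z. \<Sum>j. f j z) m = (\<Sum>j. circle_fourier_coeff (f j) m)"
      using S(2)[of m] by (simp add: sums_iff)
    also have "\<dots> = (\<Sum>j\<in>{n}. circle_fourier_coeff (f j) m)"
      by (rule suminf_finite) (auto simp: F n_def)
    finally have G: "circle_fourier_coeff (\<lambda>z. \<Sum>j. f j z) m = circle_fourier_coeff (f n) m" by simp
    show "(1 + real_of_int \<bar>m\<bar>) * R ^ nat \<bar>m\<bar> * cmod (circle_fourier_coeff (\<lambda>z. \<Sum>n. f n z) m) \<le> 2"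
    proof (cases "n = 0")
      case True
      then show ?thesis unfolding G F by simp
    next
      case False
      have "cmod (circle_fourier_coeff (f n) m) \<le> 1 / (R ^ n * (2 * real n))"
        using False y by (auto simp: F norm_mult norm_divide norm_power n_def)
      then have "(1 + real n) * R ^ n * cmod (circle_fourier_coeff (f n) m) \<le>
          (1 + real n) * R ^ n * (1 / (R ^ n * (2 * real n)))"
        using R by (intro mult_left_mono) auto
      also have "\<dots> \<le> 2" using False R by (simp add: field_simps)
      finally show ?thesis unfolding G by (simp add: n_def)
    qed
  qed
  then show ?thesis
  proof (rule fourier_decay_cong)
    fix z :: complex assume "z \<in> sphere 0 1"
    then have "cmod (z / y) < 1" using R y by (simp add: norm_divide)
    from ln_cmod_one_minus_sums[OF this] show "(\<Sum>n. f n z) = of_real (ln (cmod (1 - z / y)))"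
      by (simp add: f_def sums_iff)
  qed
qed

section \<open>The field of point charges on an exterior circle\<close>

text \<open>
A crude bound suffices: it uses up only one of the two factorials in the denominators of the
series of \<open>Y\<^sub>0\<close>.
\<close>

lemma cmod_harm_le_fact: "cmod (harm n) \<le> fact n"
proof -
  have "cmod (harm n) \<le> (\<Sum>k = 1..n. 1)"
    unfolding harm_def by (rule sum_norm_le) (auto simp: norm_divide inverse_eq_divide)
  also have "\<dots> \<le> real (fact n)"
    using fact_ge_self[of n] by (simp only: sum_constant card_atLeastAtMost)
  finally show ?thesis by simp
qed

text \<open>
The ascending series express \<open>J\<^sub>0\<close> and the regular part of \<open>Y\<^sub>0\<close> at \<open>k |z - y|\<close> as entire functions
of \<open>|z - y|\<^sup>2\<close>; the remaining factor of \<open>Y\<^sub>0\<close> is \<open>ln (k |z - y| / 2) = ln (k R / 2) + ln |1 - z / y|\<close>.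
That \<open>K\<close> does not depend on \<open>y\<close> is essential, since the charges move when \<open>N\<close> changes.
\<close>

lemma fourier_decay_hankel1_0:
  assumes k: "k > 0" and R: "R > 1"
  obtains K where "K > 0"
    and "\<And>y. cmod y = R \<Longrightarrow> fourier_decay R K (\<lambda>z. hankel1_0 (of_real (k * cmod (z - y))))"
proof
  \<comment> \<open>The numbers \<open>c0\<close> and \<open>c1\<close> collect the factors of \<open>J\<^sub>0\<close>: the Hankel function equals
      \<open>J\<^sub>0 (c0 + c1 ln |1 - z / y|) - c1 S\<close>, where \<open>S\<close> is the series with harmonic numbers.\<close>
  define a where "a = k\<^sup>2 / 4"
  define c1 :: complex where "c1 = 2 * \<i> / of_real pi"
  define c0 where "c0 = 1 + c1 * (of_real (ln (k * R / 2)) + euler_mascheroni)"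
  define E where "E = exp (a * (5 * R\<^sup>2 + 1))"
  define K where "K = (cmod c0 * 1 + cmod c1 * 2) * E + cmod (- c1) * (1 * E)"
  have "c1 \<noteq> 0" by (simp add: c1_def)
  then show "K > 0"
    unfolding K_def E_def by (intro add_nonneg_pos mult_nonneg_nonneg mult_pos_pos) auto
  fix y assume y: "cmod y = R"
  define bJ :: "nat \<Rightarrow> complex" where "bJ = (\<lambda>n. (-1) ^ n * of_real a ^ n / (fact n)\<^sup>2)"
  define bY :: "nat \<Rightarrow> complex" where "bY = (\<lambda>n. (-1) ^ n * harm n * of_real a ^ n / (fact n)\<^sup>2)"
  have a: "a \<ge> 0" by (simp add: a_def)
  have bJ: "cmod (bJ n) \<le> a ^ n / fact n" for n
  proof -
    have "cmod (bJ n) = a ^ n / (fact n)\<^sup>2"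
      using a by (simp add: bJ_def norm_mult norm_divide norm_power)
    also have "\<dots> \<le> a ^ n / fact n"
      using a by (intro divide_left_mono) (auto simp: power2_eq_square)
    finally show ?thesis .
  qed
  have bY: "cmod (bY n) \<le> a ^ n / fact n" for n
  proof -
    have "cmod (bY n) = cmod (harm n) * (a ^ n / (fact n)\<^sup>2)"
      using a by (simp add: bY_def norm_mult norm_divide norm_power)
    also have "\<dots> \<le> fact n * (a ^ n / (fact n)\<^sup>2)"
      using a by (intro mult_right_mono cmod_harm_le_fact) auto
    finally show ?thesis by (simp add: power2_eq_square)
  qed
  let ?w = "\<lambda>z. complex_of_real ((cmod (z - y))\<^sup>2)"
  let ?J = "\<lambda>z. \<Sum>n. bJ n * ?w z ^ n"
  let ?Y = "\<lambda>z. \<Sum>n. bY n * ?w z ^ n"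
  let ?L = "\<lambda>z. complex_of_real (ln (cmod (1 - z / y)))"
  have g: "fourier_decay R (cmod c0 * 1 + cmod c1 * 2) (\<lambda>z. c0 * 1 + c1 * ?L z)"
    using R y by (intro fourier_decay_add fourier_decay_cmult fourier_decay_const_1 fourier_decay_ln_dist) auto
  have R': "R \<ge> 1" using R by simp
  have "fourier_decay R K (\<lambda>z. ?J z * (c0 * 1 + c1 * ?L z) + (- c1) * (?Y z * 1))"
    unfolding K_def E_def using R
    by (intro fourier_decay_add fourier_decay_cmult fourier_decay_entire_dist_squared[OF g R' y bJ a]
          fourier_decay_entire_dist_squared[OF fourier_decay_const_1 R' y bY a]) auto
  then show "fourier_decay R K (\<lambda>z. hankel1_0 (of_real (k * cmod (z - y))))"
  proof (rule fourier_decay_cong)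
    fix z :: complex assume z: "z \<in> sphere 0 1"
    let ?x = "complex_of_real (k * cmod (z - y))"
    have pw: "(?x / 2) ^ (2 * n) = of_real a ^ n * ?w z ^ n" for n
    proof -
      have "(?x / 2) ^ 2 = of_real a * ?w z"
        by (simp add: a_def power_mult_distrib power_divide)
      then show ?thesis by (simp only: power_mult power_mult_distrib)
    qed
    have J: "bessel_J0 ?x = ?J z"
      unfolding bessel_J0_def pw by (simp add: bJ_def mult_ac)
    have Y: "(\<Sum>n. (-1) ^ n * harm n * (?x / 2) ^ (2 * n) / (fact n)\<^sup>2) = ?Y z"
      unfolding pw by (simp add: bY_def mult_ac)
    have "y \<noteq> 0" "z \<noteq> y" using z y R by auto
    then have d: "cmod (z - y) = R * cmod (1 - z / y)" and "cmod (1 - z / y) > 0"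
      by (auto simp: y[symmetric] norm_mult[symmetric] right_diff_distrib norm_minus_commute)
    have "Ln (?x / 2) = of_real (ln (k * cmod (z - y) / 2))"
      using k \<open>z \<noteq> y\<close> Ln_of_real[of "k * cmod (z - y) / 2"] by simp
    also have "k * cmod (z - y) / 2 = (k * R / 2) * cmod (1 - z / y)"
      by (simp add: d)
    also have "ln \<dots> = ln (k * R / 2) + ln (cmod (1 - z / y))"
      using k R \<open>cmod (1 - z / y) > 0\<close> by (intro ln_mult_pos) auto
    finally have L: "Ln (?x / 2) = of_real (ln (k * R / 2)) + ?L z" by simp
    show "?J z * (c0 * 1 + c1 * ?L z) + (- c1) * (?Y z * 1) = hankel1_0 ?x"
      unfolding hankel1_0_def bessel_Y0_def J Y L c0_def c1_def
      by (simp add: algebra_simps add_divide_distrib diff_divide_distrib)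
  qed
qed

lemma cmod_charge_point: "R \<ge> 0 \<Longrightarrow> cmod (charge_point R N j) = R"
  by (simp add: charge_point_def norm_mult)

text \<open>
All charge points lie on the circle of radius \<open>R\<close>, so the decay constants add up to \<open>K\<close> times the sum
of the \<open>|\<alpha>\<^sub>j|\<close>, which Cauchy-Schwarz turns into the Euclidean norm.
\<close>

lemma fourier_decay_mfs:
  assumes R: "R \<ge> 0"
    and H: "\<And>y. cmod y = R \<Longrightarrow> fourier_decay R K (\<lambda>z. hankel1_0 (of_real (k * cmod (z - y))))"
  shows "fourier_decay R (K / 4 * (sqrt (real N) * coeff_norm N \<alpha>)) (mfs k R N \<alpha>)"
proof -
  have Hj: "fourier_decay R K (\<lambda>z. hankel1_0 (of_real (k * cmod (z - charge_point R N j))))" for j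
    by (intro H cmod_charge_point R)
  then have K: "K \<ge> 0" by (rule fourier_decay_nonneg)
  have dec: "fourier_decay R (cmod (\<i> / 4) * (\<Sum>j = 1..N. cmod (\<alpha> j) * K)) (mfs k R N \<alpha>)"
    unfolding mfs_def by (intro fourier_decay_cmult fourier_decay_sum Hj R) auto
  have "(\<Sum>j = 1..N. cmod (\<alpha> j)) \<le> sqrt (real N) * coeff_norm N \<alpha>"
    using L2_set_mult_ineq[of "\<lambda>j. cmod (\<alpha> j)" "\<lambda>_. 1" "{1..N}"]
    by (simp add: coeff_norm_def L2_set_def mult_ac)
  then have "K / 4 * (\<Sum>j = 1..N. cmod (\<alpha> j)) \<le> K / 4 * (sqrt (real N) * coeff_norm N \<alpha>)"
    using K by (intro mult_left_mono) auto
  moreover have "cmod (\<i> / 4) * (\<Sum>j = 1..N. cmod (\<alpha> j) * K) = K / 4 * (\<Sum>j = 1..N. cmod (\<alpha> j))"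
    by (simp add: norm_divide sum_distrib_right[symmetric])
  ultimately show ?thesis
    by (metis fourier_decay_mono[OF dec])
qed

section \<open>Growth of the coefficient vector\<close>

theorem theorem7:
  fixes k R \<rho> c c\<^sub>v :: real and v :: "complex \<Rightarrow> complex"
  assumes "k > 0"
    and "R > \<rho>" and "\<rho> > 1"
    and "analytic_boundary_data v"
    and "c\<^sub>v > 0"
    and "\<And>m :: int. cmod (circle_fourier_coeff v m) \<ge> c\<^sub>v * \<rho> powi (- \<bar>m\<bar>)"
    and "c > 0"
  shows "\<exists>C > 0. \<forall>(N :: nat) (\<alpha> :: nat \<Rightarrow> complex).
           N > 0 \<longrightarrow> even N \<longrightarrow> real N > 3 + N_min \<rho> c c\<^sub>v \<longrightarrow>
           boundary_error k R v N \<alpha> \<le> c * \<rho> powr (- (real N / 2)) \<longrightarrow>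
           coeff_norm N \<alpha> \<ge> C * sqrt (real N) * (R / \<rho>) powr (real N / 2)"
proof -
  note pos = \<open>R > \<rho>\<close> \<open>\<rho> > 1\<close> \<open>c\<^sub>v > 0\<close> \<open>c > 0\<close>
  have R: "R > 1" using pos by simp
  obtain K where K: "K > 0"
    and H: "\<And>y. cmod y = R \<Longrightarrow> fourier_decay R K (\<lambda>z. hankel1_0 (of_real (k * cmod (z - y))))"
    using fourier_decay_hankel1_0[OF \<open>k > 0\<close> R] by blast
  have v: "continuous_on (sphere 0 1) v"
  proof -
    obtain f where "f analytic_on sphere 0 1" and f: "\<forall>x\<in>sphere 0 1. f x = v x"
      using assms(4) unfolding analytic_boundary_data_def by blast
    then have "continuous_on (sphere 0 1) f"
      using analytic_imp_holomorphic holomorphic_on_imp_continuous_on by blast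
    then show ?thesis using continuous_on_cong[OF refl, of "sphere 0 1" f v] f by blast
  qed
  \<comment> \<open>\<open>\<rho>\<^sup>L = sqrt (2 / pi) c / c\<^sub>v\<close>. An index at distance at least \<open>L\<close> below \<open>N / 2\<close> therefore has data
      coefficient at least twice the error \<open>c \<rho>\<^sup>-\<^sup>N\<^sup>/\<^sup>2 / sqrt (2 * pi)\<close>.\<close>
  define L where "L = ln (sqrt (2 / pi) * (c / c\<^sub>v)) / ln \<rho>"
  define D where "D = nat \<lceil>max L 1\<rceil>"
  have D: "max L 1 \<le> real D" "real D < max L 1 + 1" by (auto simp: D_def) linarith+
  define C where "C = c\<^sub>v / (K * (real D + 1) * (R / \<rho>) ^ D)"
  have "C > 0" unfolding C_def using pos K by (intro divide_pos_pos mult_pos_pos) auto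
  moreover have "coeff_norm N \<alpha> \<ge> C * sqrt (real N) * (R / \<rho>) powr (real N / 2)"
    if "N > 0" "even N" and N: "real N > 3 + N_min \<rho> c c\<^sub>v"
      and err: "boundary_error k R v N \<alpha> \<le> c * \<rho> powr (- (real N / 2))" for N \<alpha>
  proof -
    obtain M where M: "N = 2 * M" using \<open>even N\<close> by blast
    \<comment> \<open>The assumption on \<open>N\<close> is what makes the index \<open>N / 2 - D\<close> nonnegative.\<close>
    have "real M > 3 / 2 + max L 1" using N by (simp add: N_min_def L_def M)
    with D have "real D < real M + 1" by linarith
    then have "D \<le> M" by linarith
    define m where "m = M - D"
    have Mm: "M = m + D" using \<open>D \<le> M\<close> by (simp add: m_def)
    let ?u = "mfs k R N \<alpha>"
    have dec: "fourier_decay R (K / 4 * (sqrt (real N) * coeff_norm N \<alpha>)) ?u"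
      using R by (intro fourier_decay_mfs H) auto
    note u = fourier_decayD(1)[OF dec]
    have "sqrt (2 / pi) * (c / c\<^sub>v) = \<rho> powr L"
      using pos by (simp add: L_def powr_def)
    also have "\<dots> \<le> \<rho> powr real D" using D pos by (intro powr_mono) auto
    finally have Lc: "sqrt (2 / pi) * (c / c\<^sub>v) \<le> \<rho> ^ D" using pos by (simp add: powr_realpow)
    have s2: "sqrt (2 / pi) = 2 / sqrt (2 * pi)"
      by (simp add: real_sqrt_divide real_sqrt_mult field_simps)
    have "cmod (circle_fourier_coeff ?u m - circle_fourier_coeff v m) \<le> boundary_error k R v N \<alpha> / sqrt (2 * pi)"
      unfolding boundary_error_def circle_fourier_coeff_diff[OF u v, symmetric]
      by (intro cmod_circle_fourier_coeff_le continuous_intros u v)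
    also have "\<dots> \<le> c / \<rho> ^ M / sqrt (2 * pi)"
    proof (intro divide_right_mono)
      have "\<rho> powr (- (real N / 2)) = inverse (\<rho> ^ M)"
        using pos by (simp add: M powr_minus powr_realpow)
      with err show "boundary_error k R v N \<alpha> \<le> c / \<rho> ^ M" by (simp only: divide_inverse)
    qed simp
    also have "\<dots> = (c\<^sub>v / 2) * (sqrt (2 / pi) * (c / c\<^sub>v)) / \<rho> ^ M"
      using pos by (simp add: s2 field_simps)
    also have "\<dots> \<le> (c\<^sub>v / 2) * \<rho> ^ D / \<rho> ^ M"
      using pos Lc by (intro divide_right_mono mult_left_mono) auto
    also have "\<dots> = (c\<^sub>v / 2) / \<rho> ^ m"
      using pos by (simp add: Mm power_add)
    finally have diff: "cmod (circle_fourier_coeff ?u m - circle_fourier_coeff v m) \<le> (c\<^sub>v / 2) / \<rho> ^ m" .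
    have "c\<^sub>v / \<rho> ^ m \<le> cmod (circle_fourier_coeff v m)"
    proof -
      have "\<rho> powi (- \<bar>int m\<bar>) = inverse (\<rho> ^ m)" by (simp add: power_int_minus)
      then show ?thesis using assms(6)[of "int m"] by (simp only: divide_inverse)
    qed
    then have "(c\<^sub>v / 2) / \<rho> ^ m \<le> cmod (circle_fourier_coeff ?u m)"
      using diff norm_triangle_sub[of "circle_fourier_coeff v m" "circle_fourier_coeff ?u m"]
      by (simp add: norm_minus_commute)
    then have "(1 + real m) * R ^ m * ((c\<^sub>v / 2) / \<rho> ^ m) \<le> (1 + real m) * R ^ m * cmod (circle_fourier_coeff ?u m)"
      using R by (intro mult_left_mono) auto
    also have "\<dots> \<le> K / 4 * (sqrt (real N) * coeff_norm N \<alpha>)"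
      using fourier_decayD(2)[OF dec, of "int m"] by simp
    finally have main: "(1 + real m) * R ^ m * ((c\<^sub>v / 2) / \<rho> ^ m) \<le> K / 4 * (sqrt (real N) * coeff_norm N \<alpha>)" .
    \<comment> \<open>Since \<open>D\<close> is fixed, the factor \<open>1 + m\<close> is of the order of \<open>N\<close>.\<close>
    have "real N \<le> 2 * ((1 + real m) * (real D + 1))"
      by (simp add: M Mm algebra_simps)
    have q: "(R / \<rho>) ^ M = (R / \<rho>) ^ m * (R / \<rho>) ^ D" by (simp add: Mm power_add)
    have "C * real N * (R / \<rho>) ^ M \<le> C * (2 * ((1 + real m) * (real D + 1))) * (R / \<rho>) ^ M"
      using \<open>C > 0\<close> R pos \<open>real N \<le> _\<close> by (intro mult_right_mono mult_left_mono) auto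
    also have "\<dots> = (4 / K) * ((1 + real m) * R ^ m * ((c\<^sub>v / 2) / \<rho> ^ m))"
      using K pos R unfolding C_def q by (simp add: power_divide add_eq_0_iff divide_simps)
    also have "\<dots> \<le> (4 / K) * (K / 4 * (sqrt (real N) * coeff_norm N \<alpha>))"
      using main K by (intro mult_left_mono) auto
    also have "\<dots> = sqrt (real N) * coeff_norm N \<alpha>" using K by simp
    finally have "C * real N * (R / \<rho>) ^ M \<le> sqrt (real N) * coeff_norm N \<alpha>" .
    moreover have "sqrt (real N) * (C * sqrt (real N) * (R / \<rho>) ^ M) =
        C * (sqrt (real N) * sqrt (real N)) * (R / \<rho>) ^ M"
      by (simp only: mult_ac)
    ultimately have "sqrt (real N) * (C * sqrt (real N) * (R / \<rho>) ^ M) \<le> sqrt (real N) * coeff_norm N \<alpha>"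
      by (simp only: real_sqrt_mult_self abs_of_nat)
    then have "C * sqrt (real N) * (R / \<rho>) ^ M \<le> coeff_norm N \<alpha>"
      using \<open>N > 0\<close> by simp
    then show ?thesis
      using R pos by (simp add: M powr_realpow)
  qed
  ultimately show ?thesis by blast
qed

end
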